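(* Let $V$ be a countably generated Hilbert module over a unital $C^*$-algebra $A$. If $V$ has the module Schur property, then $V$ is self-dual.
   Context: Hilbert modules are right Hilbert $C^*$-modules, with $A$-valued inner product $\langle\cdot,\cdot\rangle$ that is $A$-linear in the second variable. A Hilbert $A$-module $V$ is countably generated if there is a sequence in $V$ whose finite $A$-linear combinations are norm-dense in $V$. $V$ is self-dual if every bounded $A$-linear map $f:V\to A$ is of the form $f=\langle x,\cdot\rangle$ for some $x\in V$. The topology $\tau_{\widehat V}$ on $V$ is the locally convex topology generated by the seminorms $x\mapsto\|\langle z,x\rangle\|$, $z\in V$. A sequence $\{x_n\}$ in $V$ is called $\tau_{\widehat V}$-convergent if for every $z\in V$ the sequence $\{\langle z,x_n\rangle\}$ converges in norm in $A$ (so the limit may lie in the completion of $V$ with respect to $\tau_{\widehat V}$, not necessarily in $V$). $V$ has the module Schur property if every $\tau_{\widehat V}$-convergent sequence in $V$ converges in norm (to an element of $V$). *)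

theory Defs
  imports "HOL-Analysis.Analysis"
begin

class scaleC = scaleR +
  fixes scaleC :: "complex \<Rightarrow> 'a \<Rightarrow> 'a" (infixr "*\<^sub>C" 75)
  assumes scaleR_scaleC: "r *\<^sub>R x = complex_of_real r *\<^sub>C x"

class complex_normed_vector = real_normed_vector + scaleC +
  assumes scaleC_add_right: "c *\<^sub>C (x + y) = c *\<^sub>C x + c *\<^sub>C y"
    and scaleC_add_left: "(c + d) *\<^sub>C x = c *\<^sub>C x + d *\<^sub>C x"
    and scaleC_scaleC: "c *\<^sub>C d *\<^sub>C x = (c * d) *\<^sub>C x"
    and scaleC_one: "1 *\<^sub>C x = x"
    and norm_scaleC: "norm (c *\<^sub>C x) = cmod c * norm x"

class complex_banach = complex_normed_vector + complete_space

class unital_cstar_algebra = real_normed_algebra_1 + complex_banach +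
  fixes star :: "'a \<Rightarrow> 'a"
  assumes mult_scaleC_left: "(c *\<^sub>C a) * b = c *\<^sub>C (a * b)"
    and mult_scaleC_right: "a * (c *\<^sub>C b) = c *\<^sub>C (a * b)"
    and star_star: "star (star a) = a"
    and star_add: "star (a + b) = star a + star b"
    and star_scaleC: "star (c *\<^sub>C a) = cnj c *\<^sub>C star a"
    and star_mult: "star (a * b) = star b * star a"
    and norm_star_mult_self: "norm (star a * a) = (norm a)\<^sup>2"

definition cstar_spectrum :: "'a::unital_cstar_algebra \<Rightarrow> complex set" where
  "cstar_spectrum a =
     {c. \<nexists>b. b * (c *\<^sub>C 1 - a) = 1 \<and> (c *\<^sub>C 1 - a) * b = 1}"

definition cstar_positive :: "'a::unital_cstar_algebra \<Rightarrow> bool" where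
  "cstar_positive a \<longleftrightarrow> star a = a \<and> cstar_spectrum a \<subseteq> complex_of_real ` {0..}"

text \<open>
  The norm of the type \<open>'v\<close> is required to be the norm induced by the inner product,
  so membership of \<open>'v\<close> in \<^class>\<open>complex_banach\<close> expresses completeness of the module.
\<close>

locale hilbert_module =
  fixes act :: "'v::complex_banach \<Rightarrow> 'a::unital_cstar_algebra \<Rightarrow> 'v"
    and ip :: "'v \<Rightarrow> 'v \<Rightarrow> 'a"
  assumes act_add_left: "act (x + y) a = act x a + act y a"
    and act_add_right: "act x (a + b) = act x a + act x b"
    and act_mult: "act x (a * b) = act (act x a) b"
    and act_one: "act x 1 = x"
    and act_scaleC_left: "act (c *\<^sub>C x) a = c *\<^sub>C act x a"
    and act_scaleC_right: "act x (c *\<^sub>C a) = c *\<^sub>C act x a"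
    and ip_add_right: "ip x (y + z) = ip x y + ip x z"
    and ip_scaleC_right: "ip x (c *\<^sub>C y) = c *\<^sub>C ip x y"
    and ip_act_right: "ip x (act y a) = ip x y * a"
    and star_ip: "star (ip x y) = ip y x"
    and ip_positive: "cstar_positive (ip x x)"
    and ip_eq_zero: "ip x x = 0 \<Longrightarrow> x = 0"
    and norm_ip: "norm x = sqrt (norm (ip x x))"

definition countably_generated ::
  "('v::complex_banach \<Rightarrow> 'a::unital_cstar_algebra \<Rightarrow> 'v) \<Rightarrow> bool" where
  "countably_generated act \<longleftrightarrow>
     (\<exists>s :: nat \<Rightarrow> 'v. closure {\<Sum>k<n. act (s k) (a k) | (n :: nat) (a :: nat \<Rightarrow> 'a). True} = UNIV)"

text \<open>Complex linearity follows from \<open>A\<close>-linearity because the algebra is unital.\<close>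

definition bounded_module_functional ::
  "('v::complex_banach \<Rightarrow> 'a::unital_cstar_algebra \<Rightarrow> 'v) \<Rightarrow> ('v \<Rightarrow> 'a) \<Rightarrow> bool" where
  "bounded_module_functional act f \<longleftrightarrow>
     bounded_linear f \<and> (\<forall>x a. f (act x a) = f x * a)"

definition self_dual ::
  "('v::complex_banach \<Rightarrow> 'a::unital_cstar_algebra \<Rightarrow> 'v) \<Rightarrow> ('v \<Rightarrow> 'v \<Rightarrow> 'a) \<Rightarrow> bool" where
  "self_dual act ip \<longleftrightarrow>
     (\<forall>f. bounded_module_functional act f \<longrightarrow> (\<exists>x. f = (\<lambda>y. ip x y)))"

text \<open>
  Convergence with respect to the seminorms \<open>x \<mapsto> norm (ip z x)\<close>. No limit in \<open>'v\<close> is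
  demanded: the limit may lie in the completion of the module for this topology.
\<close>

definition tau_convergent ::
  "('v::complex_banach \<Rightarrow> 'v \<Rightarrow> 'a::unital_cstar_algebra) \<Rightarrow> (nat \<Rightarrow> 'v) \<Rightarrow> bool" where
  "tau_convergent ip X \<longleftrightarrow> (\<forall>z. convergent (\<lambda>n. ip z (X n)))"

definition module_schur_property ::
  "('v::complex_banach \<Rightarrow> 'v \<Rightarrow> 'a::unital_cstar_algebra) \<Rightarrow> bool" where
  "module_schur_property ip \<longleftrightarrow> (\<forall>X. tau_convergent ip X \<longrightarrow> convergent X)"

end

theory Submission
  imports Defs
begin

text \<open>
  For generators \<open>s\<^sub>k\<close> the operator \<open>K x = c (\<Sum>k<n. s\<^sub>k \<langle>s\<^sub>k, x\<rangle>)\<close> satisfies \<open>0 \<le> K \<le> 1\<close> for small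
  \<open>c > 0\<close>, so the powers of \<open>R = 1 - K\<close> are contractions that tend to \<open>0\<close> on \<open>s\<^sub>0, \<dots>, s\<^sub>n\<^sub>-\<^sub>1\<close>.
  Choosing the exponents large enough as \<open>n\<close> grows, one gets finite rank operators \<open>1 - R\<^sub>n\<close>
  that tend strongly to the identity. A bounded module functional \<open>f\<close> composed with a finite rank
  operator is of the form \<open>\<langle>w\<^sub>n, \<cdot>\<rangle>\<close>, and \<open>\<langle>z, w\<^sub>n\<rangle> \<longlonglongrightarrow> (f z)\<^sup>*\<close> for every \<open>z\<close>. By the Schur property
  \<open>w\<^sub>n\<close> converges in norm, and its limit represents \<open>f\<close>.

  The order of the algebra enters through the criterion \<open>\<exists>t. norm (t - p) \<le> t\<close> for positivity of a
  self-adjoint \<open>p\<close>, which is stable under sums and, unlike the spectral condition, needs no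
  spectral radius formula.
\<close>

section \<open>Positive elements of a \<open>C\<^sup>*\<close>-algebra\<close>

instance complex_banach \<subseteq> banach ..

section \<open>The involution\<close>

lemma star_scaleR: "star (r *\<^sub>R a) = r *\<^sub>R star (a::'a::unital_cstar_algebra)"
  by (simp add: scaleR_scaleC star_scaleC)

lemma linear_star: "linear (star :: 'a::unital_cstar_algebra \<Rightarrow> 'a)"
  by (rule linearI) (simp_all add: star_add star_scaleR)

lemmas star_0 [simp] = linear_0 [OF linear_star]
lemmas star_diff = linear_diff [OF linear_star]
lemmas star_minus = linear_neg [OF linear_star]
lemmas star_sum = linear_sum [OF linear_star]

lemma star_one [simp]: "star (1::'a::unital_cstar_algebra) = 1"
  by (metis mult.left_neutral mult.right_neutral star_mult star_star)

lemma star_of_real [simp]: "star (of_real r :: 'a::unital_cstar_algebra) = of_real r"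
  by (simp add: of_real_def star_scaleR)

lemma norm_star [simp]: "norm (star a) = norm (a::'a::unital_cstar_algebra)"
proof -
  have le: "norm b \<le> norm (star b)" for b :: 'a
  proof (cases "norm b = 0")
    case False
    have "norm b * norm b \<le> norm (star b) * norm b"
      by (metis norm_mult_ineq norm_star_mult_self power2_eq_square)
    then show ?thesis using False by simp
  qed simp
  show ?thesis using le[of a] le[of "star a"] by (simp add: star_star)
qed

lemma bounded_linear_star: "bounded_linear (star :: 'a::unital_cstar_algebra \<Rightarrow> 'a)"
  by (rule bounded_linear_intro[of _ 1]) (simp_all add: star_add star_scaleR)

lemmas tendsto_star = bounded_linear.tendsto [OF bounded_linear_star]

lemma norm_square_selfadjoint:
  "star h = h \<Longrightarrow> norm (h * h) = (norm (h::'a::unital_cstar_algebra))\<^sup>2"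
  using norm_star_mult_self[of h] by simp

lemma of_real_mult_commute: "x * of_real r = of_real r * (x::'a::real_algebra_1)"
  by (simp add: of_real_def)

section \<open>Square roots of \<open>1 - q\<close> in the closed unit ball\<close>

text \<open>Fixed-point iteration for \<open>2 w = q + w * w\<close>, which says
  \<open>(1 - w) * (1 - w) = 1 - q\<close>. The type is general so that the real sequence with
  \<open>q = 1\<close> can serve as a majorant.\<close>

primrec sqrt_iter :: "'a::real_algebra_1 \<Rightarrow> nat \<Rightarrow> 'a" where
  "sqrt_iter q 0 = 0"
| "sqrt_iter q (Suc n) = (1/2) *\<^sub>R (q + sqrt_iter q n * sqrt_iter q n)"

lemma norm_square_diff_le:
  fixes x y :: "'a::real_normed_algebra"
  shows "norm (x * x - y * y) \<le> (norm x + norm y) * norm (x - y)"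
proof -
  have "x * x - y * y = x * (x - y) + (x - y) * y" by (simp add: algebra_simps)
  also have "norm \<dots> \<le> norm x * norm (x - y) + norm (x - y) * norm y"
    by (meson add_mono norm_mult_ineq norm_triangle_ineq order_trans)
  finally show ?thesis by (simp add: algebra_simps)
qed

text \<open>The recursion has nonnegative coefficients, so the real sequence with
  \<open>q = 1\<close> dominates norms and increments. This includes the boundary case
  \<open>norm q = 1\<close>, where no geometric rate is available.\<close>

lemma sqrt_iter_bounds:
  fixes q :: "'a::real_normed_algebra_1"
  assumes "norm q \<le> 1"
  shows "norm (sqrt_iter q n) \<le> sqrt_iter 1 n"
    and "sqrt_iter 1 n \<le> (1::real)"
    and "norm (sqrt_iter q (Suc n) - sqrt_iter q n) \<le> sqrt_iter 1 (Suc n) - sqrt_iter 1 n"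
proof -
  show a: "norm (sqrt_iter q n) \<le> sqrt_iter 1 n" for n
  proof (induction n)
    case (Suc n)
    have "norm (q + sqrt_iter q n * sqrt_iter q n) \<le> 1 + norm (sqrt_iter q n) * norm (sqrt_iter q n)"
      by (meson add_mono assms norm_mult_ineq norm_triangle_ineq order_trans)
    also have "\<dots> \<le> 1 + sqrt_iter 1 n * sqrt_iter 1 n"
      using Suc by (intro add_left_mono mult_mono) (auto intro: order_trans[OF norm_ge_zero])
    finally show ?case by simp
  qed simp
  have r0: "0 \<le> sqrt_iter (1::real) n" for n
    using a[of n] norm_ge_zero order_trans by blast
  show "sqrt_iter 1 n \<le> (1::real)"
  proof (induction n)
    case (Suc n)
    then show ?case using r0[of n] mult_mono[of "sqrt_iter 1 n" 1 "sqrt_iter 1 n" "1::real"] by simp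
  qed simp
  show "norm (sqrt_iter q (Suc n) - sqrt_iter q n) \<le> sqrt_iter 1 (Suc n) - sqrt_iter 1 n"
  proof (induction n)
    case 0
    then show ?case using assms by simp
  next
    case (Suc n)
    let ?x = "sqrt_iter q (Suc n)" and ?y = "sqrt_iter q n"
    let ?r = "sqrt_iter (1::real) (Suc n)" and ?s = "sqrt_iter (1::real) n"
    have "sqrt_iter q (Suc (Suc n)) - ?x = (1/2) *\<^sub>R (?x * ?x - ?y * ?y)"
      by (simp only: sqrt_iter.simps(2)[of q "Suc n"] sqrt_iter.simps(2)[of q n])
         (simp add: algebra_simps)
    then have "norm (sqrt_iter q (Suc (Suc n)) - ?x) = norm (?x * ?x - ?y * ?y) / 2"
      by simp
    also have "\<dots> \<le> (norm ?x + norm ?y) * norm (?x - ?y) / 2"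
      by (intro divide_right_mono norm_square_diff_le) simp
    also have "\<dots> \<le> (?r + ?s) * (?r - ?s) / 2"
      by (intro divide_right_mono mult_mono add_mono a Suc add_nonneg_nonneg r0) auto
    also have "\<dots> = sqrt_iter 1 (Suc (Suc n)) - ?r"
      by (simp only: sqrt_iter.simps(2)[of 1 "Suc n"] sqrt_iter.simps(2)[of 1 n])
         (simp add: field_simps)
    finally show ?case .
  qed
qed

text \<open>The real majorant increases and is bounded by 1, so its increments are summable; by
  comparison so are those of \<open>sqrt_iter q\<close>, which telescope.\<close>

lemma convergent_sqrt_iter:
  fixes q :: "'a::{real_normed_algebra_1,banach}"
  assumes "norm q \<le> 1"
  shows "convergent (sqrt_iter q)"
proof -
  let ?r = "sqrt_iter (1::real)"
  have step: "?r n \<le> ?r (Suc n)" for n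
    using order_trans[OF norm_ge_zero sqrt_iter_bounds(3)[OF assms, of n]] by linarith
  have "\<exists>B. \<forall>n. ?r n \<le> B"
    using sqrt_iter_bounds(2)[OF assms] by blast
  moreover have "incseq ?r" using step by (intro incseq_SucI)
  ultimately have "convergent ?r"
    using incseq_convergent[of ?r] unfolding convergent_def by blast
  then have "summable (\<lambda>n. ?r (Suc n) - ?r n)"
    using telescope_summable[of ?r] by (auto simp: convergent_def)
  then have "summable (\<lambda>n. sqrt_iter q (Suc n) - sqrt_iter q n)"
    by (rule summable_comparison_test') (rule sqrt_iter_bounds(3)[OF assms])
  then have "convergent (\<lambda>n. \<Sum>k<n. sqrt_iter q (Suc k) - sqrt_iter q k)"
    by (rule summable_iff_convergent[THEN iffD1])
  then show ?thesis by (simp only: sum_lessThan_telescope) simp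
qed

text \<open>The root is \<open>1 - w\<close> for the limit \<open>w\<close> of the iteration;
  self-adjointness, the norm bound and commutation hold for each iterate and pass to the limit. The
  bound on \<open>1 - h\<close> makes scaled roots positive later on.\<close>

lemma sqrt_one_minus:
  fixes q :: "'a::unital_cstar_algebra"
  assumes "star q = q" "norm q \<le> 1"
  obtains h where "star h = h" "h * h = 1 - q" "norm (1 - h) \<le> 1"
    "\<And>x. x * q = q * x \<Longrightarrow> x * h = h * x"
proof -
  obtain w where w: "sqrt_iter q \<longlonglongrightarrow> w"
    using convergent_sqrt_iter[OF assms(2)] by (auto simp: convergent_def)
  have "(\<lambda>n. (1/2) *\<^sub>R (q + sqrt_iter q n * sqrt_iter q n)) \<longlonglongrightarrow> (1/2) *\<^sub>R (q + w * w)"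
    by (rule tendsto_scaleR[OF tendsto_const tendsto_add[OF tendsto_const tendsto_mult[OF w w]]])
  then have "(\<lambda>n. sqrt_iter q (Suc n)) \<longlonglongrightarrow> (1/2) *\<^sub>R (q + w * w)"
    by simp
  with LIMSEQ_Suc[OF w] have "w = (1/2) *\<^sub>R (q + w * w)"
    by (rule LIMSEQ_unique)
  from arg_cong[OF this, of "scaleR 2"] have "w + w = q + w * w"
    by (simp add: scaleR_2)
  then have "q = w + w - w * w"
    by (simp only: add_diff_cancel_right')
  then have sq: "(1 - w) * (1 - w) = 1 - q"
    by (simp only:) (simp add: algebra_simps)
  have "star (sqrt_iter q n) = sqrt_iter q n" for n
    by (induction n) (simp_all add: star_scaleR star_add star_mult assms)
  then have "(\<lambda>n. star (sqrt_iter q n)) \<longlonglongrightarrow> w"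
    using w by simp
  with tendsto_star[OF w] have sa: "star w = w"
    by (rule LIMSEQ_unique)
  have "norm (sqrt_iter q n) \<le> 1" for n
    using sqrt_iter_bounds[OF assms(2), of n] by linarith
  then have nw: "norm w \<le> 1"
    using Lim_bounded[OF tendsto_norm[OF w]] by blast
  have comm: "x * w = w * x" if "x * q = q * x" for x
  proof -
    have "x * sqrt_iter q n = sqrt_iter q n * x" for n
    proof (induction n)
      case (Suc n)
      then have "x * (sqrt_iter q n * sqrt_iter q n) = sqrt_iter q n * sqrt_iter q n * x"
        by (metis mult.assoc)
      then show ?case using that by (simp add: distrib_left distrib_right)
    qed simp
    with tendsto_mult_left[OF w, of x] have "(\<lambda>n. sqrt_iter q n * x) \<longlonglongrightarrow> x * w"
      by simp
    then show ?thesis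
      using tendsto_mult_right[OF w] by (rule LIMSEQ_unique)
  qed
  show thesis
  proof (rule that[of "1 - w"])
    show "star (1 - w) = 1 - w" by (simp add: star_diff sa)
    show "x * (1 - w) = (1 - w) * x" if "x * q = q * x" for x
      using comm[OF that] by (simp add: left_diff_distrib right_diff_distrib)
  qed (use sq nw in simp_all)
qed

section \<open>The positive cone, its square roots and its order\<close>

definition norm_positive :: "'a::unital_cstar_algebra \<Rightarrow> bool" where
  "norm_positive p \<longleftrightarrow> star p = p \<and> (\<exists>t. norm (of_real t - p) \<le> t)"

lemma norm_positive_selfadjoint: "norm_positive p \<Longrightarrow> star p = p"
  by (simp add: norm_positive_def)

text \<open>The commuting pair forms an element \<open>u\<close> with real part \<open>h\<close> and
  \<open>star u * u = of_real t\<close>, so the C*-identity gives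
  \<open>norm h \<le> norm u = sqrt t\<close>.\<close>

lemma norm_le_of_sum_squares:
  fixes h k :: "'a::unital_cstar_algebra"
  assumes "star h = h" "star k = k" "h * k = k * h" "h * h + k * k = of_real t"
    and "0 \<le> t"
  shows "(norm h)\<^sup>2 \<le> t"
proof -
  define u where "u = h + \<i> *\<^sub>C k"
  have su: "star u = h + (-\<i>) *\<^sub>C k"
    by (simp add: u_def star_add star_scaleC assms)
  have z: "(-\<i>) *\<^sub>C x + \<i> *\<^sub>C x = 0" for x :: 'a
    using scaleC_add_left[of "-\<i>" \<i> x] norm_scaleC[of 0 x] by simp
  have i: "(-\<i>) *\<^sub>C \<i> *\<^sub>C x = x" for x :: 'a
    by (simp add: scaleC_scaleC scaleC_one)
  have "star u * u = h * h + \<i> *\<^sub>C (h * k) + ((-\<i>) *\<^sub>C (k * h) + (-\<i>) *\<^sub>C \<i> *\<^sub>C (k * k))"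
    unfolding su unfolding u_def
    by (simp only: distrib_left distrib_right mult_scaleC_left mult_scaleC_right scaleC_add_right)
      (simp add: algebra_simps scaleC_scaleC)
  also have "\<dots> = h * h + ((-\<i>) *\<^sub>C (h * k) + \<i> *\<^sub>C (h * k)) + k * k"
    using assms(3) by (simp add: i algebra_simps)
  also have "\<dots> = of_real t"
    using assms(4) by (simp add: z)
  finally have uu: "star u * u = of_real t" .
  have nu: "(norm u)\<^sup>2 = \<bar>t\<bar>"
    using norm_star_mult_self[of u] uu by (simp add: norm_of_real)
  have "star u + u = 2 *\<^sub>R h + ((-\<i>) *\<^sub>C k + \<i> *\<^sub>C k)"
    unfolding su unfolding u_def by (simp add: scaleR_2)
  then have "2 *\<^sub>R h = star u + u" by (simp add: z)
  then have "2 * norm h \<le> norm u + norm u"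
    using norm_triangle_ineq[of "star u" u] norm_scaleR[of 2 h] by simp
  then have a: "(norm h)\<^sup>2 \<le> \<bar>t\<bar>" unfolding nu[symmetric] by (intro power_mono) auto
  show ?thesis using a assms(5) by simp
qed

text \<open>For \<open>t > 0\<close> the element \<open>of_real t - h * h\<close> has a self-adjoint
  root \<open>k\<close> that commutes with \<open>h\<close>; \<open>norm_le_of_sum_squares\<close>
  with \<open>h\<close> and \<open>k\<close> exchanged bounds \<open>k\<close>.\<close>

lemma norm_diff_square_le:
  fixes h :: "'a::unital_cstar_algebra"
  assumes "star h = h" "(norm h)\<^sup>2 \<le> t"
  shows "norm (of_real t - h * h) \<le> t"
proof (cases "t = 0")
  case True
  then have "norm h = 0" using assms(2) by simp
  then show ?thesis using True by simp
next
  case False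
  then have t: "t > 0" using assms(2) zero_le_power2[of "norm h"] by linarith
  define q where "q = (1/t) *\<^sub>R (h * h)"
  have "norm q = (norm h)\<^sup>2 / t"
    using t by (simp add: q_def norm_square_selfadjoint assms(1))
  then have nq: "norm q \<le> 1" using t assms(2) by simp
  have "star q = q" by (simp add: q_def star_scaleR star_mult assms(1))
  then obtain g where g: "star g = g" "g * g = 1 - q" "\<And>x. x * q = q * x \<Longrightarrow> x * g = g * x"
    using nq by (rule sqrt_one_minus) blast
  define k where "k = sqrt t *\<^sub>R g"
  have k: "star k = k" by (simp add: k_def star_scaleR g(1))
  have kk: "k * k = of_real t - h * h"
  proof -
    have "k * k = t *\<^sub>R (1 - q)" using t by (simp add: k_def g(2))
    also have "\<dots> = of_real t - h * h"
      using t by (simp add: q_def scaleR_diff_right of_real_def)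
    finally show ?thesis .
  qed
  have "h * g = g * h" by (rule g(3)) (simp add: q_def mult.assoc)
  then have "k * h = h * k" by (simp add: k_def)
  then have "(norm k)\<^sup>2 \<le> t"
    using t kk by (intro norm_le_of_sum_squares[of k h]) (use k assms in simp_all)
  then show ?thesis using norm_square_selfadjoint[OF k] kk by simp
qed

lemma norm_positive_square: "star h = h \<Longrightarrow> norm_positive (h * h)"
  using norm_diff_square_le[of h] by (auto simp: norm_positive_def star_mult)

text \<open>For a nonzero witness \<open>t\<close>, the criterion puts
  \<open>q = (t - p) / t\<close> in the unit ball, and \<open>1 - q = p / t\<close>. Scaling the
  root of \<open>1 - q\<close> by \<open>sqrt t\<close> gives a root of \<open>p\<close> for which
  \<open>sqrt t\<close> is again a witness.\<close>

lemma norm_positive_sqrt: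
  fixes p :: "'a::unital_cstar_algebra"
  assumes "norm_positive p"
  obtains h where "norm_positive h" "h * h = p" "\<And>x. x * p = p * x \<Longrightarrow> x * h = h * x"
proof -
  obtain t where t: "norm (of_real t - p) \<le> t" and sp: "star p = p"
    using assms by (auto simp: norm_positive_def)
  show thesis
  proof (cases "t = 0")
    case True
    then have "p = 0" using t by simp
    then show thesis by (intro that[of 0]) (auto simp: norm_positive_def intro: exI[of _ 0])
  next
    case False
    then have tp: "t > 0" using t norm_ge_zero[of "of_real t - p"] by linarith
    define q where "q = (1/t) *\<^sub>R (of_real t - p)"
    have nq: "norm q \<le> 1" using t tp by (simp add: q_def)
    have "star q = q" by (simp add: q_def star_scaleR star_diff sp)
    then obtain g where g: "star g = g" "g * g = 1 - q" "norm (1 - g) \<le> 1"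
      "\<And>x. x * q = q * x \<Longrightarrow> x * g = g * x"
      using nq by (rule sqrt_one_minus) blast
    have tq: "t *\<^sub>R q = of_real t - p" using tp by (simp add: q_def)
    show thesis
    proof (rule that[of "sqrt t *\<^sub>R g"])
      have "of_real (sqrt t) - sqrt t *\<^sub>R g = sqrt t *\<^sub>R (1 - g)"
        by (simp add: of_real_def scaleR_diff_right)
      then have "norm (of_real (sqrt t) - sqrt t *\<^sub>R g) \<le> sqrt t"
        using g(3) tp mult_left_mono[of "norm (1 - g)" 1 "sqrt t"] by simp
      then show "norm_positive (sqrt t *\<^sub>R g)"
        by (auto simp: norm_positive_def star_scaleR g(1))
      have "sqrt t *\<^sub>R g * sqrt t *\<^sub>R g = t *\<^sub>R (1 - q)" using tp by (simp add: g(2))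
      also have "\<dots> = p" by (simp add: scaleR_diff_right tq) (simp add: of_real_def)
      finally show "sqrt t *\<^sub>R g * sqrt t *\<^sub>R g = p" .
      show "x * sqrt t *\<^sub>R g = sqrt t *\<^sub>R g * x" if "x * p = p * x" for x
      proof -
        have "x * q = q * x"
          using that by (simp add: q_def right_diff_distrib left_diff_distrib of_real_mult_commute)
        from g(4)[OF this] show ?thesis by simp
      qed
    qed
  qed
qed

text \<open>The definition provides a single witness; writing \<open>p\<close> as a square makes
  every \<open>t \<ge> norm p\<close> a witness.\<close>

lemma norm_positive_bound:
  assumes "norm_positive p" "norm p \<le> t"
  shows "norm (of_real t - p) \<le> t"
proof -
  obtain h where h: "norm_positive h" "h * h = p"
    using norm_positive_sqrt[OF assms(1)] by metis
  then show ?thesis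
    using norm_diff_square_le[of h t] norm_square_selfadjoint[of h] assms(2)
    by (simp add: norm_positive_selfadjoint)
qed

lemma norm_positive_add:
  assumes "norm_positive a" "norm_positive b"
  shows "norm_positive (a + b)"
proof -
  obtain s t where "norm (of_real s - a) \<le> s" "norm (of_real t - b) \<le> t"
    using assms by (auto simp: norm_positive_def)
  then have "norm ((of_real s - a) + (of_real t - b)) \<le> s + t"
    by (intro norm_triangle_le) simp
  moreover have "(of_real s - a) + (of_real t - b) = of_real (s + t) - (a + b)"
    by simp
  ultimately have "norm (of_real (s + t) - (a + b)) \<le> s + t" by (simp only:)
  then show ?thesis
    using assms by (auto simp: norm_positive_def star_add intro: exI[of _ "s + t"])
qed

lemma norm_positive_scaleR:
  assumes "norm_positive a" "0 \<le> r"
  shows "norm_positive (r *\<^sub>R a)"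
proof -
  obtain t where t: "norm (of_real t - a) \<le> t"
    using assms by (auto simp: norm_positive_def)
  have "of_real (r * t) - r *\<^sub>R a = r *\<^sub>R (of_real t - a)"
    by (simp add: of_real_def scaleR_diff_right)
  then have "norm (of_real (r * t) - r *\<^sub>R a) \<le> r * t"
    using t assms(2) by (simp add: mult_left_mono del: of_real_mult)
  then show ?thesis
    using assms(1) unfolding norm_positive_def star_scaleR by metis
qed

lemma norm_positive_of_norm_le:
  assumes "star b = b" "norm b \<le> t"
  shows "norm_positive (of_real t - b)"
  using assms by (auto simp: norm_positive_def star_diff intro: exI[of _ t])

lemma norm_positive_of_real: "0 \<le> r \<Longrightarrow> norm_positive (of_real r)"
  by (auto simp: norm_positive_def intro: exI[of _ r])

lemma norm_positive_0 [simp]: "norm_positive 0"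
  using norm_positive_of_real[of 0] by simp

lemma norm_positive_sum: "(\<And>i. i \<in> I \<Longrightarrow> norm_positive (f i)) \<Longrightarrow> norm_positive (sum f I)"
  by (induction I rule: infinite_finite_induct) (auto intro: norm_positive_add)

text \<open>The roots \<open>h\<close> and \<open>k\<close> commute as well, so the product is the
  square of the self-adjoint element \<open>h * k\<close>.\<close>

lemma norm_positive_mult:
  assumes "norm_positive a" "norm_positive b" "a * b = b * a"
  shows "norm_positive (a * b)"
proof -
  obtain h where h: "norm_positive h" "h * h = a" "\<And>x. x * a = a * x \<Longrightarrow> x * h = h * x"
    using norm_positive_sqrt[OF assms(1)] by metis
  obtain k where k: "norm_positive k" "k * k = b" "\<And>x. x * b = b * x \<Longrightarrow> x * k = k * x"
    using norm_positive_sqrt[OF assms(2)] by metis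
  \<comment> \<open>\<open>b\<close> commutes with \<open>a\<close>, hence with its root
    \<open>h\<close>; so \<open>h\<close> commutes with \<open>b\<close>, hence with its root
    \<open>k\<close>.\<close>
  have hk: "h * k = k * h" using h(3)[of b] k(3)[of h] assms(3) by simp
  have "a * b = (h * k) * (h * k)" using hk h(2) k(2) by (metis mult.assoc)
  moreover have "star (h * k) = h * k"
    using hk by (simp add: star_mult norm_positive_selfadjoint h(1) k(1))
  ultimately show ?thesis by (simp add: norm_positive_square)
qed

text \<open>The roots of \<open>a\<close> and \<open>of_real t - a\<close> commute and their squares
  add up to \<open>t\<close>, the situation of \<open>norm_le_of_sum_squares\<close>.\<close>

lemma norm_le_of_norm_positive:
  fixes a :: "'a::unital_cstar_algebra"
  assumes "norm_positive a" "norm_positive (of_real t - a)"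
  shows "norm a \<le> t"
proof -
  \<comment> \<open>The sign of \<open>t\<close> comes from the sum of the two positive elements,
    which is \<open>of_real t\<close>: \<open>\<bar>s - t\<bar> \<le> s\<close> forces
    \<open>t \<ge> 0\<close>.\<close>
  obtain s where "norm (of_real s - of_real t :: 'a) \<le> s"
    using norm_positive_add[OF assms] by (auto simp: norm_positive_def)
  then have t: "0 \<le> t" using norm_of_real[of "s - t", where 'a = 'a] by simp
  obtain h where h: "norm_positive h" "h * h = a" "\<And>x. x * a = a * x \<Longrightarrow> x * h = h * x"
    using norm_positive_sqrt[OF assms(1)] by metis
  obtain k where k: "norm_positive k" "k * k = of_real t - a"
    "\<And>x. x * (of_real t - a) = (of_real t - a) * x \<Longrightarrow> x * k = k * x"
    using norm_positive_sqrt[OF assms(2)] by metis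
  have "h * a = a * h" using h(2) by (metis mult.assoc)
  then have "h * k = k * h"
    by (intro k(3)) (simp add: right_diff_distrib left_diff_distrib of_real_mult_commute)
  moreover have "h * h + k * k = of_real t" by (simp only: h(2) k(2)) simp
  ultimately have "(norm h)\<^sup>2 \<le> t"
    by (intro norm_le_of_sum_squares[of h k] norm_positive_selfadjoint h(1) k(1) t)
  then show ?thesis
    using norm_square_selfadjoint[of h] h(1,2) by (simp add: norm_positive_selfadjoint)
qed

lemma norm_mono_norm_positive:
  assumes "norm_positive a" "norm_positive (b - a)"
  shows "norm a \<le> norm b"
proof (rule norm_le_of_norm_positive[OF assms(1)])
  have "star b = b"
    using norm_positive_add[OF assms] by (simp add: norm_positive_selfadjoint)
  then have "norm_positive (of_real (norm b) - b)"
    by (rule norm_positive_of_norm_le) simp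
  from norm_positive_add[OF this assms(2)]
  show "norm_positive (of_real (norm b) - a)" by simp
qed

text \<open>The inverse \<open>g\<close> is self-adjoint, so \<open>norm g - g\<close> is positive
  and commutes with \<open>p\<close>; the product with \<open>p\<close> is
  \<open>norm g * p - 1\<close>.\<close>

lemma norm_positive_bounded_below:
  assumes "norm_positive p" "g * p = 1" "p * g = 1"
  shows "0 < norm g" "norm_positive (p - of_real (1 / norm g))"
proof -
  show g: "0 < norm g" using assms(3) by auto
  have "star g * p = 1"
    using assms(1,3) star_mult[of p g] by (simp add: norm_positive_selfadjoint)
  then have "star g = g" using assms(3) by (metis mult.assoc mult.left_neutral mult.right_neutral)
  then have "norm_positive (of_real (norm g) - g)"
    by (rule norm_positive_of_norm_le) simp
  then have "norm_positive ((of_real (norm g) - g) * p)"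
    using assms by (intro norm_positive_mult)
      (simp_all add: right_diff_distrib left_diff_distrib of_real_mult_commute)
  then have "norm_positive ((1 / norm g) *\<^sub>R ((of_real (norm g) - g) * p))"
    by (rule norm_positive_scaleR) simp
  moreover have "(1 / norm g) *\<^sub>R ((of_real (norm g) - g) * p) = p - of_real (1 / norm g)"
    using g by (simp add: left_diff_distrib assms scaleR_diff_right of_real_def)
  ultimately show "norm_positive (p - of_real (1 / norm g))" by (simp only:)
qed

text \<open>The infimum of all \<open>l \<ge> 0\<close> for which \<open>l + a\<close> is positive cannot be strictly positive:
  a positive invertible element stays positive after subtracting a small constant.\<close>

lemma norm_positive_of_invertible:
  fixes a :: "'a::unital_cstar_algebra"
  assumes "star a = a"
    and "\<And>e. e > 0 \<Longrightarrow> \<exists>b. b * (of_real e + a) = 1 \<and> (of_real e + a) * b = 1"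
  shows "norm_positive a"
proof -
  define S where "S = {l. 0 \<le> l \<and> norm_positive (of_real l + a)}"
  have "norm_positive (of_real (norm a) - (- a))"
    by (rule norm_positive_of_norm_le) (simp_all add: star_minus assms(1))
  then have "norm a \<in> S" by (simp add: S_def)
  then have ne: "S \<noteq> {}" by blast
  have bb: "bdd_below S" by (rule bdd_belowI[of _ 0]) (simp add: S_def)
  define m where "m = Inf S"
  have m0: "0 \<le> m" unfolding m_def by (rule cInf_greatest[OF ne]) (simp add: S_def)
  \<comment> \<open>One radius for all \<open>l\<close> in \<open>S\<close> with
    \<open>l < m + 1\<close>: it bounds \<open>norm (of_real l + a)\<close>, so the criterion
    survives the limit from \<open>l\<close> to \<open>m\<close> and the infimum is
    attained.\<close>
  define T where "T = m + 1 + norm a"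
  have "norm (of_real T - (of_real m + a)) \<le> T"
  proof (rule field_le_epsilon)
    fix e :: real assume e: "e > 0"
    define d where "d = min e 1"
    have d: "d > 0" "d \<le> e" "d \<le> 1" using e by (auto simp: d_def)
    then obtain l where l: "l \<in> S" "l < m + d"
      using cInf_lessD[OF ne, of "m + d"] by (auto simp: m_def)
    have ml: "m \<le> l" unfolding m_def by (rule cInf_lower[OF l(1) bb])
    have "norm (of_real l + a) \<le> T"
      using norm_triangle_ineq[of "of_real l" a] l(2) ml m0 d by (simp add: T_def)
    then have "norm (of_real T - (of_real l + a)) \<le> T"
      using l(1) by (intro norm_positive_bound) (simp add: S_def)
    moreover have "norm (of_real (l - m) :: 'a) \<le> e"
      unfolding norm_of_real using l(2) ml d by linarith
    ultimately have "norm ((of_real T - (of_real l + a)) + of_real (l - m)) \<le> T + e"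
      by (intro norm_triangle_le) simp
    then show "norm (of_real T - (of_real m + a)) \<le> T + e" by (simp add: algebra_simps)
  qed
  then have pm: "norm_positive (of_real m + a)"
    by (auto simp: norm_positive_def star_add assms(1))
  show ?thesis
  proof (cases "m = 0")
    case True
    then show ?thesis using pm by simp
  next
    case False
    then have m: "m > 0" using m0 by simp
    obtain g where g: "g * (of_real m + a) = 1" "(of_real m + a) * g = 1"
      using assms(2)[OF m] by blast
    \<comment> \<open>The minimum with \<open>m\<close> keeps \<open>m - d\<close> nonnegative, as
      membership in \<open>S\<close> demands.\<close>
    define d where "d = min m (1 / norm g)"
    have d: "d > 0" "d \<le> m" "d \<le> 1 / norm g"
      using m norm_positive_bounded_below(1)[OF pm g] by (auto simp: d_def)
    have "norm_positive ((of_real m + a - of_real (1 / norm g)) + of_real (1 / norm g - d))"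
      using norm_positive_bounded_below(2)[OF pm g] d
      by (intro norm_positive_add norm_positive_of_real) simp_all
    also have "(of_real m + a - of_real (1 / norm g)) + of_real (1 / norm g - d)
        = of_real (m - d) + a"
      by (simp only: of_real_diff) (simp add: algebra_simps)
    finally have "m - d \<in> S" using d by (simp add: S_def)
    then have "m \<le> m - d" unfolding m_def by (rule cInf_lower[OF _ bb])
    then show ?thesis using d by simp
  qed
qed

text \<open>That \<open>- e\<close> lies outside the spectrum means that \<open>e + a\<close> is
  invertible. This carries the spectral positivity of the module axioms over to the norm
  criterion.\<close>

lemma norm_positive_of_cstar_positive:
  fixes a :: "'a::unital_cstar_algebra"
  assumes "cstar_positive a"
  shows "norm_positive a"
proof (rule norm_positive_of_invertible)
  show "star a = a" using assms by (simp add: cstar_positive_def)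
  fix e :: real assume "e > 0"
  then have "complex_of_real (- e) \<notin> complex_of_real ` {0..}" by (auto simp del: of_real_minus)
  then have "complex_of_real (- e) \<notin> cstar_spectrum a"
    using assms by (auto simp: cstar_positive_def)
  then obtain b where b: "b * (complex_of_real (- e) *\<^sub>C 1 - a) = 1"
    "(complex_of_real (- e) *\<^sub>C 1 - a) * b = 1"
    by (auto simp: cstar_spectrum_def)
  have "complex_of_real (- e) *\<^sub>C 1 - a = - (of_real e + a)"
    using scaleR_scaleC[of "- e" "1::'a"] by (simp add: of_real_def[where 'a = 'a])
  then show "\<exists>b. b * (of_real e + a) = 1 \<and> (of_real e + a) * b = 1"
    using b by (intro exI[of _ "- b"]) (simp only: mult_minus_left mult_minus_right)
qed

section \<open>Neumann series and positivity of \<open>star x * x\<close>\<close>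

lemma one_minus_invertible:
  fixes x :: "'a::{real_normed_algebra_1,banach}"
  assumes "norm x < 1"
  obtains y where "y * (1 - x) = 1" "(1 - x) * y = 1"
proof -
  have s: "summable (\<lambda>n. x ^ n)" by (rule complete_algebra_summable_geometric[OF assms])
  have e: "(\<Sum>n. x ^ Suc n) = (\<Sum>n. x ^ n) - 1"
    using suminf_split_head[OF s] by simp
  have "x * (\<Sum>n. x ^ n) = (\<Sum>n. x ^ n) - 1"
    using suminf_mult[OF s, of x] e by simp
  moreover have "(\<Sum>n. x ^ n) * x = (\<Sum>n. x ^ n) - 1"
    using suminf_mult2[OF s, of x] e by (simp add: power_commutes)
  ultimately show thesis
    by (intro that[of "\<Sum>n. x ^ n"]) (simp_all add: right_diff_distrib left_diff_distrib)
qed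

text \<open>\<open>(e + p) / (t + e)\<close> differs from 1 by \<open>(t - p) / (t + e)\<close>, of
  norm at most \<open>t / (t + e) < 1\<close>, so the Neumann series inverts it.\<close>

lemma norm_positive_add_invertible:
  fixes p :: "'a::unital_cstar_algebra"
  assumes "norm_positive p" "e > 0"
  obtains b where "b * (of_real e + p) = 1" "(of_real e + p) * b = 1"
proof -
  obtain t where t: "norm (of_real t - p) \<le> t" using assms by (auto simp: norm_positive_def)
  then have te: "t + e > 0" using norm_ge_zero[of "of_real t - p"] assms(2) by linarith
  have "norm ((1 / (t + e)) *\<^sub>R (of_real t - p)) < 1"
    using t te assms(2) by simp
  then obtain y where y: "y * (1 - (1 / (t + e)) *\<^sub>R (of_real t - p)) = 1"
    "(1 - (1 / (t + e)) *\<^sub>R (of_real t - p)) * y = 1"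
    by (rule one_minus_invertible)
  have *: "1 - (1 / (t + e)) *\<^sub>R (of_real t - p) = (1 / (t + e)) *\<^sub>R (of_real e + p)"
  proof -
    have "(1::'a) = (1 / (t + e)) *\<^sub>R of_real (t + e)" using te by (simp add: of_real_def)
    then have "1 - (1 / (t + e)) *\<^sub>R (of_real t - p)
        = (1 / (t + e)) *\<^sub>R (of_real (t + e) - (of_real t - p))"
      by (simp only: scaleR_diff_right)
    then show ?thesis by simp
  qed
  show thesis
    by (rule that[of "(1 / (t + e)) *\<^sub>R y"]) (use y in \<open>simp_all add: *\<close>)
qed

text \<open>The two products have the same spectrum away from 0: if \<open>b\<close> inverts
  \<open>e - star y * y\<close>, then \<open>(1 + y * b * star y) / e\<close> inverts
  \<open>e - y * star y\<close>.\<close>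

lemma norm_positive_minus_mult_star:
  fixes y :: "'a::unital_cstar_algebra"
  assumes "norm_positive (- (star y * y))"
  shows "norm_positive (- (y * star y))"
proof (rule norm_positive_of_invertible)
  show "star (- (y * star y)) = - (y * star y)"
    by (simp add: star_minus star_mult star_star)
  fix e :: real assume e: "e > 0"
  obtain b where b: "b * (of_real e - star y * y) = 1" "(of_real e - star y * y) * b = 1"
    using norm_positive_add_invertible[OF assms e] by auto
  define c where "c = 1 + y * b * star y"
  have "(of_real e - y * star y) * c
      = of_real e - y * star y + y * ((of_real e - star y * y) * b) * star y"
    by (simp add: c_def algebra_simps of_real_mult_commute)
      (simp add: of_real_def)
  then have 1: "(of_real e - y * star y) * c = of_real e" by (simp add: b)
  have "c * (of_real e - y * star y)
      = of_real e - y * star y + y * (b * (of_real e - star y * y)) * star y"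
    by (simp add: c_def algebra_simps of_real_mult_commute)
      (simp add: of_real_def)
  then have 2: "c * (of_real e - y * star y) = of_real e" by (simp add: b)
  show "\<exists>b. b * (of_real e + - (y * star y)) = 1 \<and> (of_real e + - (y * star y)) * b = 1"
    using 1 2 e by (intro exI[of _ "(1 / e) *\<^sub>R c"]) (simp add: of_real_def)
qed

text \<open>With \<open>u = y + star y\<close> and the skew element \<open>d = y - star y\<close>,
  the sum is \<open>(u * u - d * d) / 2\<close>, and \<open>- (d * d)\<close> is the square of the
  self-adjoint element \<open>i d\<close>.\<close>

lemma norm_positive_star_mult_add:
  fixes y :: "'a::unital_cstar_algebra"
  shows "norm_positive (star y * y + y * star y)"
proof -
  define u d where "u = y + star y" and "d = y - star y"
  have "star (\<i> *\<^sub>C d) = (- \<i>) *\<^sub>C (- d)"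
    by (simp add: d_def star_scaleC star_diff star_star)
  also have "- d = (- 1) *\<^sub>C d"
    using scaleR_scaleC[of "- 1" d] by simp
  also have "(- \<i>) *\<^sub>C (- 1) *\<^sub>C d = \<i> *\<^sub>C d"
    by (simp add: scaleC_scaleC)
  finally have "norm_positive (\<i> *\<^sub>C d * \<i> *\<^sub>C d)" by (rule norm_positive_square)
  also have "\<i> *\<^sub>C d * \<i> *\<^sub>C d = - (d * d)"
    using scaleR_scaleC[of "- 1" "d * d"]
    by (simp add: mult_scaleC_left mult_scaleC_right scaleC_scaleC)
  finally have "norm_positive (- (d * d))" .
  moreover have "norm_positive (u * u)"
    by (rule norm_positive_square) (simp add: u_def star_add star_star add.commute)
  ultimately have "norm_positive ((1/2) *\<^sub>R (u * u + - (d * d)))"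
    by (intro norm_positive_scaleR norm_positive_add) simp_all
  also have "u * u + - (d * d) = 2 *\<^sub>R (star y * y + y * star y)"
    by (simp add: u_def d_def algebra_simps scaleR_2)
  finally show ?thesis by simp
qed

text \<open>With \<open>h = x\<^sup>*x\<close>, \<open>r = \<bar>h\<bar>\<close> and \<open>n = r - h\<close>, the element \<open>y = x n\<close> satisfies \<open>y\<^sup>*y = - r n\<^sup>2 \<le> 0\<close>,
  which forces \<open>y = 0\<close> and then \<open>n = 0\<close>.\<close>

lemma norm_positive_star_mult:
  fixes x :: "'a::unital_cstar_algebra"
  shows "norm_positive (star x * x)"
proof -
  define h where "h = star x * x"
  have sh: "star h = h" by (simp add: h_def star_mult star_star)
  obtain r where r: "norm_positive r" "r * r = h * h" "\<And>z. z * (h * h) = (h * h) * z \<Longrightarrow> z * r = r * z"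
    using norm_positive_sqrt[OF norm_positive_square[OF sh]] by metis
  have hr: "h * r = r * h" by (rule r(3)) (simp add: mult.assoc)
  define n where "n = r - h"
  have sn: "star n = n" by (simp add: n_def star_diff sh norm_positive_selfadjoint r(1))
  have rn: "r * n = n * r" using hr by (simp add: n_def algebra_simps)
  have hn: "h * n = - (r * n)" using hr r(2) by (simp add: n_def algebra_simps)
  define y where "y = x * n"
  have "star y * y = n * (h * n)" by (simp add: y_def h_def star_mult sn mult.assoc)
  also have "\<dots> = - (n * r * n)" by (simp add: hn mult.assoc)
  also have "\<dots> = - (r * (n * n))" by (simp only: rn[symmetric] mult.assoc)
  finally have yy: "- (star y * y) = r * (n * n)" by simp
  have "r * (n * n) = n * r * n" by (simp only: rn[symmetric] mult.assoc)
  also have "\<dots> = n * n * r" by (simp only: rn mult.assoc)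
  finally have "norm_positive (r * (n * n))"
    by (intro norm_positive_mult r(1) norm_positive_square sn)
  then have neg: "norm_positive (- (star y * y))" by (simp only: yy)
  \<comment> \<open>Adding \<open>- (y * star y)\<close> to the positive sum of both products leaves
    \<open>star y * y\<close>. It is then positive together with its negative, hence 0.\<close>
  have "norm_positive (star y * y)"
    using norm_positive_add[OF norm_positive_star_mult_add[of y] norm_positive_minus_mult_star[OF neg]]
    by simp
  then have "norm (star y * y) \<le> 0"
    using neg by (intro norm_le_of_norm_positive) simp_all
  then have "y = 0" using norm_star_mult_self[of y] by simp
  then have "h * n = 0" by (simp add: y_def h_def mult.assoc)
  moreover have "n * n = r * n - h * n" by (simp add: n_def left_diff_distrib)
  ultimately have "n * n = 0" using hn by simp
  then have "n = 0" using norm_square_selfadjoint[OF sn] by simp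
  then show ?thesis using r(1) by (simp add: n_def h_def)
qed

lemma norm_positive_conjugate:
  assumes "norm_positive p"
  shows "norm_positive (star a * p * a)"
proof -
  obtain h where h: "norm_positive h" "h * h = p" using norm_positive_sqrt[OF assms] by metis
  have "star a * p * a = star (h * a) * (h * a)"
    by (simp add: star_mult norm_positive_selfadjoint h(1) mult.assoc flip: h(2))
  then show ?thesis by (simp add: norm_positive_star_mult)
qed

section \<open>Hilbert modules\<close>

context hilbert_module
begin

lemma linear_ip_right: "linear (ip x)"
  by (rule linearI) (simp_all add: ip_add_right ip_scaleC_right scaleR_scaleC)

text \<open>Linearity is over the reals; for complex scalars the first slot is conjugate
  linear.\<close>

lemma linear_ip_left: "linear (\<lambda>x. ip x y)"
proof -
  have "linear (star \<circ> ip y)" by (intro linear_compose linear_ip_right linear_star)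
  then show ?thesis by (simp add: comp_def star_ip)
qed

lemma linear_act_left: "linear (\<lambda>x. act x a)"
  by (rule linearI) (simp_all add: act_add_left act_scaleC_left scaleR_scaleC)

lemmas ip_diff_right = linear_diff [OF linear_ip_right]
  and ip_diff_left = linear_diff [OF linear_ip_left]
  and ip_scaleR_right = linear_scale [OF linear_ip_right]
  and ip_scaleR_left = linear_scale [OF linear_ip_left]
  and ip_sum_right = linear_sum [OF linear_ip_right]
  and ip_sum_left = linear_sum [OF linear_ip_left]
  and ip_zero_left = linear_0 [OF linear_ip_left]

lemma ip_act_left: "ip (act x a) y = star a * ip x y"
  by (metis ip_act_right star_ip star_mult star_star)

lemma norm_positive_ip: "norm_positive (ip x x)"
  by (rule norm_positive_of_cstar_positive[OF ip_positive])

lemma norm_ip_self: "norm (ip x x) = (norm x)\<^sup>2"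
  by (simp add: norm_ip)

lemma norm_le_of_ip:
  assumes "norm_positive (ip x x - ip y y)"
  shows "norm y \<le> norm x"
  using norm_mono_norm_positive[OF norm_positive_ip assms]
  by (simp add: norm_ip_self power2_le_iff_abs_le)

text \<open>Expand \<open>ip z z\<close> for \<open>z = act s a - N *\<^sub>R y\<close> with
  \<open>a = ip s y\<close>, replace the middle factor \<open>ip s s\<close> by its upper bound
  \<open>N\<close>, and divide by \<open>N\<close>.\<close>

lemma Cauchy_Schwarz_positive:
  "norm_positive ((norm s)\<^sup>2 *\<^sub>R ip y y - star (ip s y) * ip s y)"
proof (cases "s = 0")
  case True
  then show ?thesis by (simp add: ip_zero_left)
next
  case False
  define N a p where "N = (norm s)\<^sup>2" and "a = ip s y" and "p = ip s s"
  have N: "N > 0" using False by (simp add: N_def)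
  have sa: "ip y s = star a" by (simp add: a_def star_ip)
  define z where "z = act s a - N *\<^sub>R y"
  have z: "ip z z = star a * p * a - N *\<^sub>R (star a * a) - N *\<^sub>R (star a * a) + N *\<^sub>R N *\<^sub>R ip y y"
    by (simp add: z_def ip_diff_left ip_diff_right ip_act_left ip_act_right ip_scaleR_left
        ip_scaleR_right sa p_def[symmetric] a_def[symmetric] mult.assoc algebra_simps)
  have "norm_positive (of_real N - p)"
    by (rule norm_positive_of_norm_le) (simp_all add: p_def star_ip norm_ip_self N_def)
  from norm_positive_conjugate[OF this, of a]
  have "norm_positive (N *\<^sub>R (star a * a) - star a * p * a)"
    by (simp add: right_diff_distrib left_diff_distrib of_real_def)
  from norm_positive_add[OF this norm_positive_ip[of z]]
  have "norm_positive (N *\<^sub>R N *\<^sub>R ip y y - N *\<^sub>R (star a * a))"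
    by (simp add: z)
  then have "norm_positive ((1 / N) *\<^sub>R (N *\<^sub>R N *\<^sub>R ip y y - N *\<^sub>R (star a * a)))"
    by (rule norm_positive_scaleR) (use N in simp)
  then show ?thesis
    using N by (simp add: scaleR_diff_right N_def[symmetric] a_def[symmetric])
qed

lemma norm_ip_le: "norm (ip x y) \<le> norm x * norm y"
proof -
  have "norm (star (ip x y) * ip x y) \<le> norm ((norm x)\<^sup>2 *\<^sub>R ip y y)"
    by (intro norm_mono_norm_positive norm_positive_star_mult Cauchy_Schwarz_positive)
  then have "(norm (ip x y))\<^sup>2 \<le> (norm x * norm y)\<^sup>2"
    by (simp only: norm_star_mult_self norm_scaleR norm_ip_self power_mult_distrib) simp
  then show ?thesis by (rule power2_le_imp_le) simp
qed

lemma bounded_linear_ip_left: "bounded_linear (\<lambda>x. ip x y)"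
  by (rule bounded_linear_intro[of _ "norm y"])
    (simp_all add: linear_add[OF linear_ip_left] ip_scaleR_left norm_ip_le)

lemma norm_act_le: "norm (act x a) \<le> norm x * norm a"
proof -
  have "(norm (act x a))\<^sup>2 = norm (star a * ip x x * a)"
    by (simp add: norm_ip_self[symmetric] ip_act_left ip_act_right mult.assoc)
  also have "\<dots> \<le> norm (star a) * norm (ip x x) * norm a"
    by (meson mult_right_mono norm_ge_zero norm_mult_ineq order_trans)
  also have "\<dots> = (norm x * norm a)\<^sup>2"
    by (simp add: norm_ip_self power2_eq_square)
  finally show ?thesis by (rule power2_le_imp_le) simp
qed

end

section \<open>Approximation of the identity\<close>

text \<open>The operator inequalities \<open>0 \<le> K \<le> 1\<close> are stated through quadratic
  forms, so that they are inequalities in the algebra.\<close>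

locale positive_contraction = hilbert_module act ip
  for act :: "'v::complex_banach \<Rightarrow> 'a::unital_cstar_algebra \<Rightarrow> 'v" and ip +
  fixes K :: "'v \<Rightarrow> 'v"
  assumes linear_K: "linear K"
    and ip_K: "ip (K x) y = ip x (K y)"
    and K_positive: "norm_positive (ip x (K x))"
    and K_le_1: "norm_positive (ip x x - ip x (K x))"
begin

definition R :: "'v \<Rightarrow> 'v" where "R x = x - K x"

lemma linear_R_power: "linear (R ^^ m)"
proof (induction m)
  case 0
  show ?case by (simp add: linear_iff)
next
  case (Suc m)
  have "linear R"
    unfolding R_def[abs_def] by (intro linear_compose_sub linear_ident linear_K)
  with Suc show ?case by (simp add: linear_compose[unfolded comp_def] comp_def)
qed

lemma ip_R_power: "ip ((R ^^ m) x) y = ip x ((R ^^ m) y)"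
proof (induction m arbitrary: x y)
  case (Suc m)
  have "ip (R u) v = ip u (R v)" for u v
    by (simp add: R_def ip_diff_left ip_diff_right ip_K)
  then show ?case by (simp add: Suc funpow_swap1)
qed simp

text \<open>This is \<open>K - K\<^sup>2 = K (1 - K) K + (1 - K) K (1 - K) \<ge> 0\<close>.\<close>

lemma R_square_le: "norm_positive (ip x x - ip x (K x) - ip (R x) (R x))"
proof -
  have "ip x x - ip x (K x) - ip (R x) (R x)
      = (ip (K x) (K x) - ip (K x) (K (K x))) + ip (R x) (K (R x))"
    by (simp add: R_def ip_diff_left ip_diff_right linear_diff[OF linear_K] ip_K)
  then show ?thesis
    by (simp only:) (intro norm_positive_add K_le_1 K_positive)
qed

text \<open>This is \<open>K - R K R = K\<^sup>2 + K (1 - K) K \<ge> 0\<close>: the form of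
  \<open>K\<close> decreases along the orbit of \<open>R\<close>.\<close>

lemma K_R_le: "norm_positive (ip x (K x) - ip (R x) (K (R x)))"
proof -
  have "ip x (K x) - ip (R x) (K (R x))
      = ip (K x) (K x) + (ip (K x) (K x) - ip (K x) (K (K x)))"
    by (simp add: R_def ip_diff_left ip_diff_right linear_diff[OF linear_K] ip_K)
  then show ?thesis
    by (simp only:) (intro norm_positive_add K_le_1 norm_positive_ip)
qed

text \<open>By \<open>R_square_le\<close> each application of \<open>R\<close> to \<open>y\<close>
  lowers \<open>ip y y\<close> by at least \<open>ip y (K y)\<close>. These losses decrease by
  \<open>K_R_le\<close>, so \<open>m\<close> of them exceed \<open>m\<close> times the next
  one.\<close>

lemma R_power_positive:
  "norm_positive (ip x x - ip ((R ^^ m) x) ((R ^^ m) x)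
     - real m *\<^sub>R ip ((R ^^ m) x) (K ((R ^^ m) x)))"
proof (induction m)
  case (Suc m)
  define y where "y = (R ^^ m) x"
  have y: "(R ^^ Suc m) x = R y" by (simp add: y_def)
  have "norm_positive ((ip x x - ip y y - real m *\<^sub>R ip y (K y))
      + (ip y y - ip y (K y) - ip (R y) (R y))
      + real (Suc m) *\<^sub>R (ip y (K y) - ip (R y) (K (R y))))"
    using Suc unfolding y_def[symmetric]
    by (intro norm_positive_add norm_positive_scaleR K_R_le R_square_le) simp_all
  also have "(ip x x - ip y y - real m *\<^sub>R ip y (K y))
      + (ip y y - ip y (K y) - ip (R y) (R y))
      + real (Suc m) *\<^sub>R (ip y (K y) - ip (R y) (K (R y)))
      = ip x x - ip (R y) (R y) - real (Suc m) *\<^sub>R ip (R y) (K (R y))"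
    by (simp add: scaleR_diff_right scaleR_add_left algebra_simps)
  finally show ?case unfolding y .
qed simp

lemma norm_R_power_le: "norm ((R ^^ m) x) \<le> norm x"
proof (rule norm_le_of_ip)
  have "norm_positive (real m *\<^sub>R ip ((R ^^ m) x) (K ((R ^^ m) x)))"
    by (intro norm_positive_scaleR K_positive) simp
  from norm_positive_add[OF R_power_positive[of x m] this]
  show "norm_positive (ip x x - ip ((R ^^ m) x) ((R ^^ m) x))" by simp
qed

lemma norm_K_R_power_le: "real m * norm (ip ((R ^^ m) x) (K ((R ^^ m) x))) \<le> (norm x)\<^sup>2"
proof -
  have "norm (real m *\<^sub>R ip ((R ^^ m) x) (K ((R ^^ m) x))) \<le> norm (ip x x)"
  proof (rule norm_mono_norm_positive)
    show "norm_positive (real m *\<^sub>R ip ((R ^^ m) x) (K ((R ^^ m) x)))"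
      by (intro norm_positive_scaleR K_positive) simp
    show "norm_positive (ip x x - real m *\<^sub>R ip ((R ^^ m) x) (K ((R ^^ m) x)))"
      using norm_positive_add[OF R_power_positive[of x m] norm_positive_ip[of "(R ^^ m) x"]]
      by (simp add: algebra_simps)
  qed
  then show ?thesis by (simp add: norm_ip_self)
qed

text \<open>For \<open>y = (R ^^ (m + m)) s\<close>, self-adjointness moves half of the power to the
  other slot, so \<open>ip s y\<close> has norm \<open>(norm ((R ^^ m) s))\<^sup>2\<close>. By
  hypothesis its square is controlled by \<open>ip y (K y)\<close>, which is \<open>O(1/m)\<close>;
  hence the fourth power.\<close>

lemma R_power_tendsto_0:
  assumes c: "c > 0"
    and le: "\<And>x. norm_positive (ip x (K x) - c *\<^sub>R (star (ip s x) * ip s x))"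
  shows "(\<lambda>m. (R ^^ m) s) \<longlonglongrightarrow> 0"
proof -
  have bound: "norm ((R ^^ m) s) ^ 4 \<le> (norm s)\<^sup>2 / c * inverse (real m)" if "m > 0" for m
  proof -
    define y where "y = (R ^^ (m + m)) s"
    have "(norm ((R ^^ m) s))\<^sup>2 = norm (ip s y)"
      by (simp add: norm_ip_self[symmetric] ip_R_power y_def funpow_add)
    then have "norm ((R ^^ m) s) ^ 4 = (norm (ip s y))\<^sup>2"
      by (metis power_mult numeral_times_numeral mult_2 numeral_Bit0)
    moreover have "c * (norm (ip s y))\<^sup>2 \<le> norm (ip y (K y))"
      using norm_mono_norm_positive[OF norm_positive_scaleR[OF norm_positive_star_mult] le[of y]] c
      by (simp add: norm_star_mult_self)
    then have "real (m + m) * (c * (norm (ip s y))\<^sup>2) \<le> (norm s)\<^sup>2"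
      using norm_K_R_power_le[of "m + m" s] unfolding y_def[symmetric]
      by (meson mult_left_mono of_nat_0_le_iff order_trans)
    then have "real m * (c * (norm (ip s y))\<^sup>2) \<le> (norm s)\<^sup>2"
      using c by (smt (verit) mult_right_mono of_nat_add of_nat_0_le_iff zero_le_mult_iff zero_le_power2)
    ultimately show ?thesis using c that by (simp add: field_simps)
  qed
  have "(\<lambda>m. norm ((R ^^ m) s) ^ 4) \<longlonglongrightarrow> 0"
  proof (rule Lim_null_comparison)
    show "(\<lambda>m. (norm s)\<^sup>2 / c * inverse (real m)) \<longlonglongrightarrow> 0"
      by (intro tendsto_mult_right_zero lim_inverse_n)
    show "\<forall>\<^sub>F m in sequentially. norm (norm ((R ^^ m) s) ^ 4) \<le> (norm s)\<^sup>2 / c * inverse (real m)"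
      using eventually_gt_at_top[of 0] by eventually_elim (use bound in simp)
  qed
  then show ?thesis
    by (simp add: power_tendsto_0_iff tendsto_norm_zero_iff)
qed

end

section \<open>Frame operators of the generators\<close>

context hilbert_module
begin

text \<open>The summand 1 keeps the denominator positive even if \<open>n = 0\<close> or all
  generators vanish.\<close>

definition frame_scale :: "(nat \<Rightarrow> 'v) \<Rightarrow> nat \<Rightarrow> real" where
  "frame_scale s n = 1 / (1 + (\<Sum>k<n. (norm (s k))\<^sup>2))"

definition frame :: "(nat \<Rightarrow> 'v) \<Rightarrow> nat \<Rightarrow> 'v \<Rightarrow> 'v" where
  "frame s n x = frame_scale s n *\<^sub>R (\<Sum>k<n. act (s k) (ip (s k) x))"

lemma frame_scale_pos: "0 < frame_scale s n"
  unfolding frame_scale_def by (intro divide_pos_pos add_pos_nonneg sum_nonneg) simp_all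

lemma frame_scale_le: "frame_scale s n * (\<Sum>k<n. (norm (s k))\<^sup>2) \<le> 1"
proof -
  have "0 \<le> (\<Sum>k<n. (norm (s k))\<^sup>2)" by (intro sum_nonneg) simp
  then show ?thesis by (simp add: frame_scale_def)
qed

lemma ip_frame: "ip x (frame s n y) = frame_scale s n *\<^sub>R (\<Sum>k<n. star (ip (s k) x) * ip (s k) y)"
  by (simp add: frame_def ip_scaleR_right ip_sum_right ip_act_right star_ip)

lemma frame_act: "frame s n (act x a) = act (frame s n x) a"
  by (simp add: frame_def linear_scale[OF linear_act_left] linear_sum[OF linear_act_left]
      ip_act_right act_mult)

sublocale frame: positive_contraction act ip "frame s n" for s n
proof (intro positive_contraction.intro positive_contraction_axioms.intro)
  show "hilbert_module act ip" by unfold_locales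
  have 1: "act y (r *\<^sub>R a) = r *\<^sub>R act y a" for y a r
    by (simp add: scaleR_scaleC act_scaleC_right)
  show "linear (frame s n)"
    by (rule linearI)
      (simp_all add: frame_def linear_add[OF linear_ip_right] ip_scaleR_right act_add_right
        sum.distrib scaleR_add_right 1 scaleR_sum_right mult.commute)
  show "ip (frame s n x) y = ip x (frame s n y)" for x y
  proof -
    have "ip (frame s n x) y = star (ip y (frame s n x))" by (simp add: star_ip)
    then show ?thesis
      unfolding ip_frame by (simp add: star_scaleR star_sum star_mult star_star)
  qed
  show "norm_positive (ip x (frame s n x))" for x
    unfolding ip_frame using frame_scale_pos[of s n]
    by (intro norm_positive_scaleR norm_positive_sum norm_positive_star_mult) simp
  show "norm_positive (ip x x - ip x (frame s n x))" for x
  proof -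
    let ?c = "frame_scale s n" and ?N = "\<Sum>k<n. (norm (s k))\<^sup>2"
    \<comment> \<open>\<open>1 - K\<close> is the scaled sum of the Cauchy-Schwarz defects of the
      generators plus the slack \<open>1 - ?c * ?N\<close> times the identity.\<close>
    have "norm_positive (?c *\<^sub>R (\<Sum>k<n. (norm (s k))\<^sup>2 *\<^sub>R ip x x - star (ip (s k) x) * ip (s k) x)
        + (1 - ?c * ?N) *\<^sub>R ip x x)"
      using frame_scale_pos[of s n] frame_scale_le[of s n]
      by (intro norm_positive_add norm_positive_scaleR norm_positive_sum Cauchy_Schwarz_positive
          norm_positive_ip) simp_all
    then show ?thesis
      by (simp add: ip_frame sum_subtractf scaleR_diff_right scaleR_diff_left
          scaleR_sum_left[symmetric])
  qed
qed

lemma frame_R_power_act: "(frame.R s n ^^ m) (act x a) = act ((frame.R s n ^^ m) x) a"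
  by (induction m) (simp_all add: frame.R_def frame_act linear_diff[OF linear_act_left])

text \<open>Dropping the positive summands with index other than \<open>j\<close> bounds the frame
  operator below by the single term of \<open>s j\<close>.\<close>

lemma frame_R_power_tendsto_0:
  assumes "j < n"
  shows "(\<lambda>m. (frame.R s n ^^ m) (s j)) \<longlonglongrightarrow> 0"
proof (rule frame.R_power_tendsto_0[OF frame_scale_pos[of s n]])
  fix x
  have "norm_positive (frame_scale s n *\<^sub>R (\<Sum>k\<in>{..<n} - {j}. star (ip (s k) x) * ip (s k) x))"
    using frame_scale_pos[of s n]
    by (intro norm_positive_scaleR norm_positive_sum norm_positive_star_mult) simp
  then show "norm_positive (ip x (frame s n x) - frame_scale s n *\<^sub>R (star (ip (s j) x) * ip (s j) x))"
    using assms by (simp add: ip_frame sum_diff1 scaleR_diff_right)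
qed

lemma frame_approximation:
  assumes "closure {\<Sum>k<n. act (s k) (a k) | (n :: nat) (a :: nat \<Rightarrow> 'a). True} = UNIV"
  obtains m where "\<And>x. (\<lambda>n. (frame.R s n ^^ m n) x) \<longlonglongrightarrow> 0"
proof -
  \<comment> \<open>Only finitely many generators are involved for each \<open>n\<close>, so one
    exponent serves them all.\<close>
  have "\<exists>m. \<forall>j<n. norm ((frame.R s n ^^ m) (s j)) < inverse (real (Suc n))" for n
  proof -
    have "\<forall>\<^sub>F m in sequentially. \<forall>j\<in>{..<n}. norm ((frame.R s n ^^ m) (s j)) < inverse (real (Suc n))"
    proof (intro eventually_ball_finite ballI)
      fix j assume "j \<in> {..<n}"
      then have "(\<lambda>m. norm ((frame.R s n ^^ m) (s j))) \<longlonglongrightarrow> 0"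
        by (intro tendsto_norm_zero frame_R_power_tendsto_0) simp
      then show "\<forall>\<^sub>F m in sequentially. norm ((frame.R s n ^^ m) (s j)) < inverse (real (Suc n))"
        by (rule order_tendstoD) simp
    qed simp
    from eventually_happens'[OF _ this] show ?thesis by auto
  qed
  then obtain m where m: "\<And>n j. j < n \<Longrightarrow> norm ((frame.R s n ^^ m n) (s j)) < inverse (real (Suc n))"
    by metis
  have gen: "(\<lambda>n. (frame.R s n ^^ m n) (s j)) \<longlonglongrightarrow> 0" for j
  proof (rule Lim_null_comparison[OF _ LIMSEQ_inverse_real_of_nat])
    show "\<forall>\<^sub>F n in sequentially. norm ((frame.R s n ^^ m n) (s j)) \<le> inverse (real (Suc n))"
      using eventually_gt_at_top[of j] by eventually_elim (use m in force)
  qed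
  have comb: "(\<lambda>n. (frame.R s n ^^ m n) (\<Sum>k<l. act (s k) (a k))) \<longlonglongrightarrow> 0" for l and a :: "nat \<Rightarrow> 'a"
  proof -
    have "(\<lambda>n. act ((frame.R s n ^^ m n) (s k)) (a k)) \<longlonglongrightarrow> 0" for k
    proof (rule Lim_null_comparison)
      show "\<forall>\<^sub>F n in sequentially. norm (act ((frame.R s n ^^ m n) (s k)) (a k))
          \<le> norm ((frame.R s n ^^ m n) (s k)) * norm (a k)"
        by (simp add: norm_act_le)
      show "(\<lambda>n. norm ((frame.R s n ^^ m n) (s k)) * norm (a k)) \<longlonglongrightarrow> 0"
        by (intro tendsto_mult_left_zero tendsto_norm_zero gen)
    qed
    then have "(\<lambda>n. \<Sum>k<l. act ((frame.R s n ^^ m n) (s k)) (a k)) \<longlonglongrightarrow> 0"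
      by (intro tendsto_null_sum) simp
    then show ?thesis
      by (simp add: linear_sum[OF frame.linear_R_power] frame_R_power_act)
  qed
  have "(\<lambda>n. (frame.R s n ^^ m n) x) \<longlonglongrightarrow> 0" for x
  proof (rule tendstoI)
    fix e :: real assume e: "e > 0"
    have "x \<in> closure {\<Sum>k<n. act (s k) (a k) | (n :: nat) (a :: nat \<Rightarrow> 'a). True}"
      using assms by simp
    then obtain l and a :: "nat \<Rightarrow> 'a" where la: "dist (\<Sum>k<l. act (s k) (a k)) x < e / 2"
      unfolding closure_approachable using half_gt_zero[OF e] by blast
    define y where "y = (\<Sum>k<l. act (s k) (a k))"
    have "\<forall>\<^sub>F n in sequentially. norm ((frame.R s n ^^ m n) y) < e / 2"
      using tendsto_norm_zero[OF comb[where l = l and a = a]] unfolding y_def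
      by (rule order_tendstoD(2)) (use e in simp)
    then show "\<forall>\<^sub>F n in sequentially. dist ((frame.R s n ^^ m n) x) 0 < e"
    proof eventually_elim
      case (elim n)
      \<comment> \<open>Contractivity is uniform in \<open>n\<close>, which extends the convergence
        from the dense set of combinations to every \<open>x\<close>.\<close>
      have "norm ((frame.R s n ^^ m n) (x - y)) \<le> norm (x - y)"
        by (rule frame.norm_R_power_le)
      also have "\<dots> < e / 2" using la by (simp add: y_def dist_norm norm_minus_commute)
      finally have "norm ((frame.R s n ^^ m n) x - (frame.R s n ^^ m n) y) < e / 2"
        by (simp add: linear_diff[OF frame.linear_R_power])
      with elim show ?case
        using norm_triangle_ineq[of "(frame.R s n ^^ m n) x - (frame.R s n ^^ m n) y"
            "(frame.R s n ^^ m n) y"] by simp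
    qed
  qed
  then show thesis by (rule that)
qed

text \<open>\<open>f\<close> composed with \<open>K\<close> is represented by \<open>v\<close>,
  since \<open>f\<close> pulls the coefficients \<open>ip (s k) z\<close> out. As
  \<open>1 - R^m\<close> is the sum of \<open>K R^j\<close> over \<open>j < m\<close>,
  self-adjointness of \<open>R\<close> makes the sum of \<open>R^j v\<close> a
  representative.\<close>

lemma functional_representation:
  assumes "bounded_module_functional act f"
  obtains w where "\<And>z. f (z - (frame.R s n ^^ m) z) = ip w z"
proof -
  have lf: "linear f" and fa: "\<And>x a. f (act x a) = f x * a"
    using assms by (auto simp: bounded_module_functional_def bounded_linear.linear)
  define v where "v = frame_scale s n *\<^sub>R (\<Sum>k<n. act (s k) (star (f (s k))))"
  have v: "f (frame s n z) = ip v z" for z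
    by (simp add: v_def frame_def linear_scale[OF lf] linear_sum[OF lf] fa ip_scaleR_left
        ip_sum_left ip_act_left star_star)
  have "\<exists>w. \<forall>z. f (z - (frame.R s n ^^ m) z) = ip w z"
  proof (induction m)
    case 0
    show ?case by (rule exI[of _ 0]) (simp add: linear_0[OF lf] ip_zero_left)
  next
    case (Suc m)
    then obtain w where w: "\<And>z. f (z - (frame.R s n ^^ m) z) = ip w z" by blast
    have "f (z - (frame.R s n ^^ Suc m) z) = ip (w + (frame.R s n ^^ m) v) z" for z
    proof -
      have "z - (frame.R s n ^^ Suc m) z
          = (z - (frame.R s n ^^ m) z) + frame s n ((frame.R s n ^^ m) z)"
        by (simp add: frame.R_def)
      then have "f (z - (frame.R s n ^^ Suc m) z) = ip w z + ip v ((frame.R s n ^^ m) z)"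
        by (simp only: linear_add[OF lf] w v)
      then show ?thesis
        by (simp add: linear_add[OF linear_ip_left] frame.ip_R_power)
    qed
    then show ?case by blast
  qed
  then show thesis using that by blast
qed

end

theorem corollary6p5:
  fixes act :: "'v::complex_banach \<Rightarrow> 'a::unital_cstar_algebra \<Rightarrow> 'v"
    and ip :: "'v \<Rightarrow> 'v \<Rightarrow> 'a"
  assumes "hilbert_module act ip"
    and "countably_generated act"
    and "module_schur_property ip"
  shows "self_dual act ip"
  unfolding self_dual_def
proof (intro allI impI)
  interpret hilbert_module act ip by (rule assms(1))
  fix f assume f: "bounded_module_functional act f"
  then have bf: "bounded_linear f" by (simp add: bounded_module_functional_def)
  obtain s :: "nat \<Rightarrow> 'v"
    where "closure {\<Sum>k<n. act (s k) (a k) | (n :: nat) (a :: nat \<Rightarrow> 'a). True} = UNIV"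
    using assms(2) unfolding countably_generated_def by blast
  then obtain m where m: "(\<lambda>n. (frame.R s n ^^ m n) x) \<longlonglongrightarrow> 0" for x
    using frame_approximation by blast
  have "\<exists>w. \<forall>z. f (z - (frame.R s n ^^ m n) z) = ip w z" for n
    using functional_representation[OF f] by metis
  then obtain w where w: "\<And>n z. f (z - (frame.R s n ^^ m n) z) = ip (w n) z" by metis
  have lim: "(\<lambda>n. ip (w n) z) \<longlonglongrightarrow> f z" for z
    using bounded_linear.tendsto[OF bf tendsto_diff[OF tendsto_const[of z] m[of z]]]
    by (simp add: w)
  \<comment> \<open>The limits are known with \<open>w n\<close> in the first slot; the continuous
    involution moves it to the second, with limits \<open>star (f z)\<close>.\<close>
  have "tau_convergent ip w"
    unfolding tau_convergent_def convergent_def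
    using tendsto_star[OF lim] by (auto simp: star_ip)
  then obtain x where x: "w \<longlonglongrightarrow> x"
    using assms(3) by (auto simp: module_schur_property_def convergent_def)
  \<comment> \<open>Norm convergence of \<open>w\<close> also gives the limit \<open>ip x z\<close>
    of \<open>ip (w n) z\<close>, and limits are unique.\<close>
  have "f z = ip x z" for z
    by (rule LIMSEQ_unique[OF lim bounded_linear.tendsto[OF bounded_linear_ip_left x]])
  then show "\<exists>x. f = (\<lambda>y. ip x y)" by blast
qed

end
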